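(* Consider the semistable system $\dot x(t)=Ax(t)+Bu(t)$, $y(t)=Cx(t)$, with $A\in\mathbb{R}^{n\times n}$, $B\in\mathbb{R}^{n\times p}$, $C\in\mathbb{R}^{q\times n}$, and denote its transfer matrix by $\eta(s)=C(sI_n-A)^{-1}B$. Let $\mathcal{J}=\lim_{\tau\to\infty}e^{A\tau}$. The system belongs to $\mathcal{H}_2$ and to $\mathcal{H}_\infty$ if and only if $$C\mathcal{J}B=0.$$ Furthermore, if $C\mathcal{J}B=0$, then $$\|\eta(s)\|_{\mathcal{H}_2}^2=\mathrm{tr}(C\mathcal{P}C^\top)=\mathrm{tr}(B^\top\mathcal{Q}B),$$ where $\mathcal{P}$ and $\mathcal{Q}$ are the pseudo controllability and observability Gramians, and $\|\eta(s)\|_{\mathcal{H}_\infty}\le\gamma$ if there exist $\gamma>0$ and a symmetric matrix $\mathcal{K}\succcurlyeq 0$ satisfying $$\begin{bmatrix}A^\top\mathcal{K}+\mathcal{K}A&\mathcal{K}B&(I-\mathcal{J})^\top C^\top\\ B^\top\mathcal{K}&-\gamma I&0\\ C(I-\mathcal{J})&0&-\gamma I\end{bmatrix}\preccurlyeq 0\quad\text{and}\quad \mathcal{J}^\top\mathcal{K}\mathcal{J}=0.$$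
   Context: The system $\dot x=Ax+Bu$, $y=Cx$ is called semistable if $\lim_{t\to\infty}x(t)$ exists for all initial states $x(0)$ when $u=0$. For a semistable system, $\mathcal{J}:=\lim_{\tau\to\infty}e^{A\tau}$, and the pseudo controllability and observability Gramians are $$\mathcal{P}=\int_0^\infty(e^{A\tau}-\mathcal{J})BB^\top(e^{A^\top\tau}-\mathcal{J}^\top)\,d\tau,\qquad \mathcal{Q}=\int_0^\infty(e^{A^\top\tau}-\mathcal{J}^\top)C^\top C(e^{A\tau}-\mathcal{J})\,d\tau .$$ The system being in $\mathcal{H}_2$ (resp. $\mathcal{H}_\infty$) means that its transfer matrix $\eta(s)$ is, and $\|\eta(s)\|_{\mathcal{H}_2}^2=\mathrm{tr}\int_0^\infty g(\tau)^\top g(\tau)\,d\tau$ with impulse response $g(\tau)=Ce^{A\tau}B$. For symmetric matrices, $\succcurlyeq 0$ / $\preccurlyeq 0$ mean positive / negative semidefinite. *)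

theory Defs
  imports "HOL-Analysis.Analysis"
begin

text \<open>
  Matrices are of type \<open>'a ^ 'columns ^ 'rows\<close>. The type class operations \<open>*\<close>, \<open>^\<close>, \<open>1\<close> on this type
  are entrywise, hence powers are formed with \<open>**\<close> and \<open>mat 1\<close>. As \<open>real ^ 'n ^ 'n\<close> is no normed
  algebra, the library function \<open>exp\<close> is not available for it.
\<close>

definition matrix_exp :: "real ^ 'n ^ 'n \<Rightarrow> real ^ 'n ^ 'n"
  where "matrix_exp A = (\<Sum>k. (1 / fact k) *\<^sub>R (((**) A ^^ k) (mat 1)))"

definition semistable :: "real ^ 'n ^ 'n \<Rightarrow> bool"
  where "semistable A \<longleftrightarrow>
    (\<forall>x :: real \<Rightarrow> real ^ 'n.
       (\<forall>t\<ge>0. (x has_vector_derivative (A *v x t)) (at t within {0..}))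
         \<longrightarrow> (\<exists>l. (x \<longlongrightarrow> l) at_top))"

definition exp_limit :: "real ^ 'n ^ 'n \<Rightarrow> real ^ 'n ^ 'n"
  where "exp_limit A = Lim at_top (\<lambda>\<tau>. matrix_exp (\<tau> *\<^sub>R A))"

definition ctrl_gramian :: "real ^ 'n ^ 'n \<Rightarrow> real ^ 'p ^ 'n \<Rightarrow> real ^ 'n ^ 'n"
  where "ctrl_gramian A B = integral {0..} (\<lambda>\<tau>.
    (matrix_exp (\<tau> *\<^sub>R A) - exp_limit A) ** B ** transpose B
      ** (matrix_exp (\<tau> *\<^sub>R transpose A) - transpose (exp_limit A)))"

definition obs_gramian :: "real ^ 'n ^ 'n \<Rightarrow> real ^ 'n ^ 'q \<Rightarrow> real ^ 'n ^ 'n"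
  where "obs_gramian A C = integral {0..} (\<lambda>\<tau>.
    (matrix_exp (\<tau> *\<^sub>R transpose A) - transpose (exp_limit A)) ** transpose C ** C
      ** (matrix_exp (\<tau> *\<^sub>R A) - exp_limit A))"

definition transfer_matrix ::
    "real ^ 'n ^ 'n \<Rightarrow> real ^ 'p ^ 'n \<Rightarrow> real ^ 'n ^ 'q \<Rightarrow> complex \<Rightarrow> complex ^ 'p ^ 'q"
  where "transfer_matrix A B C s =
    map_matrix of_real C ** matrix_inv (mat s - map_matrix of_real A) ** map_matrix of_real B"

definition impulse_response ::
    "real ^ 'n ^ 'n \<Rightarrow> real ^ 'p ^ 'n \<Rightarrow> real ^ 'n ^ 'q \<Rightarrow> real \<Rightarrow> real ^ 'p ^ 'q"
  where "impulse_response A B C \<tau> = C ** matrix_exp (\<tau> *\<^sub>R A) ** B"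

definition matrix_holomorphic_on :: "(complex \<Rightarrow> complex ^ 'p ^ 'q) \<Rightarrow> complex set \<Rightarrow> bool"
  where "matrix_holomorphic_on F S \<longleftrightarrow> (\<forall>i j. (\<lambda>s. F s $ i $ j) holomorphic_on S)"

text \<open>
  The Hardy spaces of the open right half plane. The norm of \<open>complex ^ 'p ^ 'q\<close> is the Frobenius
  norm, so its square is the trace of \<open>F(s)\<^sup>* F(s)\<close>; the operator norm induced by the Euclidean
  norms is the largest singular value.
\<close>

definition in_H2 :: "(complex \<Rightarrow> complex ^ 'p ^ 'q) \<Rightarrow> bool"
  where "in_H2 F \<longleftrightarrow> matrix_holomorphic_on F {s. 0 < Re s} \<and>
    (SUP \<sigma>\<in>{0<..}. \<integral>\<^sup>+ \<omega>. ennreal ((norm (F (Complex \<sigma> \<omega>)))\<^sup>2) \<partial>lborel) < \<infinity>"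

definition Hinf_norm :: "(complex \<Rightarrow> complex ^ 'p ^ 'q) \<Rightarrow> ereal"
  where "Hinf_norm F = (SUP s\<in>{s. 0 < Re s}. ereal (onorm ((*v) (F s))))"

definition in_Hinf :: "(complex \<Rightarrow> complex ^ 'p ^ 'q) \<Rightarrow> bool"
  where "in_Hinf F \<longleftrightarrow> matrix_holomorphic_on F {s. 0 < Re s} \<and> Hinf_norm F < \<infinity>"

text \<open>
  The \<open>H\<^sub>2\<close> norm of the transfer matrix of \<open>(A, B, C)\<close>, in the time domain. It is meaningful
  only if the impulse response is square integrable on \<open>[0, \<infinity>)\<close>.
\<close>

definition H2_norm :: "real ^ 'n ^ 'n \<Rightarrow> real ^ 'p ^ 'n \<Rightarrow> real ^ 'n ^ 'q \<Rightarrow> real"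
  where "H2_norm A B C = sqrt (trace (integral {0..}
    (\<lambda>\<tau>. transpose (impulse_response A B C \<tau>) ** impulse_response A B C \<tau>)))"

definition pos_semidef :: "real ^ 'n ^ 'n \<Rightarrow> bool"
  where "pos_semidef M \<longleftrightarrow> transpose M = M \<and> (\<forall>x. 0 \<le> x \<bullet> (M *v x))"

definition neg_semidef :: "real ^ 'n ^ 'n \<Rightarrow> bool"
  where "neg_semidef M \<longleftrightarrow> transpose M = M \<and> (\<forall>x. x \<bullet> (M *v x) \<le> 0)"

text \<open>Arguments of \<open>block3\<close> are the nine blocks in row-major order.\<close>

definition block3 ::
   "'a ^ 'n ^ 'n \<Rightarrow> 'a ^ 'p ^ 'n \<Rightarrow> 'a ^ 'q ^ 'n \<Rightarrow>
    'a ^ 'n ^ 'p \<Rightarrow> 'a ^ 'p ^ 'p \<Rightarrow> 'a ^ 'q ^ 'p \<Rightarrow>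
    'a ^ 'n ^ 'q \<Rightarrow> 'a ^ 'p ^ 'q \<Rightarrow> 'a ^ 'q ^ 'q \<Rightarrow>
    'a ^ ('n + 'p + 'q) ^ ('n + 'p + 'q)"
  where "block3 M11 M12 M13 M21 M22 M23 M31 M32 M33 = (\<chi> i j.
    case i of
      Inl a \<Rightarrow>
        (case j of Inl b \<Rightarrow> M11 $ a $ b | Inr (Inl b) \<Rightarrow> M12 $ a $ b | Inr (Inr b) \<Rightarrow> M13 $ a $ b)
    | Inr (Inl a) \<Rightarrow>
        (case j of Inl b \<Rightarrow> M21 $ a $ b | Inr (Inl b) \<Rightarrow> M22 $ a $ b | Inr (Inr b) \<Rightarrow> M23 $ a $ b)
    | Inr (Inr a) \<Rightarrow>
        (case j of Inl b \<Rightarrow> M31 $ a $ b | Inr (Inl b) \<Rightarrow> M32 $ a $ b | Inr (Inr b) \<Rightarrow> M33 $ a $ b))"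

end

theory Submission
  imports Defs "HOL-Probability.Sinc_Integral"
begin

text \<open>
  The transient \<open>D t = exp (A t) - J\<close> satisfies \<open>D (s + t) = D s D t\<close> and tends to zero, hence it
  decays exponentially. Differentiating \<open>exp (- s t) D t X\<close> therefore bounds \<open>(I - J) X\<close> by a
  multiple of \<open>(s I - A) X\<close>, uniformly for \<open>Re s \<ge> 0\<close>. Since \<open>J (s I - A)\<^sup>-\<^sup>1 = J / s\<close>, the transfer
  matrix is \<open>C J B / s\<close> plus a part which is bounded and remains so after multiplication by \<open>s\<close>;
  if \<open>C J B = 0\<close> this gives both Hardy space memberships, and otherwise the pole at \<open>0\<close> excludes
  boundedness. The Gramian formulas are the cyclicity of the trace under integrals that converge by
  exponential decay. For the last bound, the quadratic form of the block matrix is evaluated at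
  the state \<open>v = (s I - A)\<^sup>-\<^sup>1 B u\<close>, the input \<open>u\<close> and \<open>C v / \<gamma>\<close>; the storage term
  \<open>2 Re (v\<^sup>* K (A v + B u)) = 2 Re s (v\<^sup>* K v)\<close> is nonnegative.
\<close>

subsection \<open>The matrix exponential\<close>

lemma norm_vec_power2: "(norm x)\<^sup>2 = (\<Sum>i\<in>UNIV. (norm (x $ i))\<^sup>2)"
  for x :: "'a::real_normed_vector ^ 'n"
  by (simp add: norm_vec_def L2_set_def sum_nonneg)

text \<open>Cauchy-Schwarz without conjugation: multiplicativity of the norm reduces it to the real
  \<open>L2_set\<close> inequality, so real and complex matrices are covered at once.\<close>

lemma norm_sum_mult_le_L2_set:
  fixes f g :: "'k \<Rightarrow> 'a::real_normed_field"
  shows "(norm (\<Sum>k\<in>S. f k * g k))\<^sup>2 \<le> (\<Sum>k\<in>S. (norm (f k))\<^sup>2) * (\<Sum>k\<in>S. (norm (g k))\<^sup>2)"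
proof -
  have "norm (\<Sum>k\<in>S. f k * g k) \<le> (\<Sum>k\<in>S. \<bar>norm (f k)\<bar> * \<bar>norm (g k)\<bar>)"
    by (rule order_trans[OF norm_sum]) (simp add: norm_mult)
  also have "\<dots> \<le> L2_set (\<lambda>k. norm (f k)) S * L2_set (\<lambda>k. norm (g k)) S"
    by (rule L2_set_mult_ineq)
  finally have "(norm (\<Sum>k\<in>S. f k * g k))\<^sup>2
      \<le> (L2_set (\<lambda>k. norm (f k)) S * L2_set (\<lambda>k. norm (g k)) S)\<^sup>2"
    by (rule power_mono) simp
  then show ?thesis
    by (simp add: power_mult_distrib L2_set_def sum_nonneg)
qed

text \<open>Cauchy-Schwarz bounds each entry of the product by a row sum times a column sum; summed
  over all entries, these bounds factor into the two squared norms.\<close>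

lemma norm_matrix_mult_le: "norm (A ** B) \<le> norm A * norm B"
  for A :: "'a::real_normed_field ^ 'n ^ 'm" and B :: "'a ^ 'p ^ 'n"
proof (rule power2_le_imp_le)
  have "(norm (A ** B))\<^sup>2 = (\<Sum>i\<in>UNIV. \<Sum>j\<in>UNIV. (norm (\<Sum>k\<in>UNIV. A $ i $ k * B $ k $ j))\<^sup>2)"
    by (simp add: norm_vec_power2 matrix_matrix_mult_def)
  also have "\<dots> \<le> (\<Sum>i\<in>UNIV. \<Sum>j\<in>UNIV.
      (\<Sum>k\<in>UNIV. (norm (A $ i $ k))\<^sup>2) * (\<Sum>k\<in>UNIV. (norm (B $ k $ j))\<^sup>2))"
    by (intro sum_mono norm_sum_mult_le_L2_set)
  also have "\<dots> = (norm A)\<^sup>2 * (norm B)\<^sup>2"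
    unfolding norm_vec_power2 sum.swap[of "\<lambda>k j. (norm (B $ k $ j))\<^sup>2"] sum_product ..
  finally show "(norm (A ** B))\<^sup>2 \<le> (norm A * norm B)\<^sup>2"
    by (simp add: power_mult_distrib)
qed simp

lemma norm_matrix_vector_mult_le: "norm (A *v x) \<le> norm A * norm x"
  for A :: "'a::real_normed_field ^ 'n ^ 'm"
proof (rule power2_le_imp_le)
  have "(norm (A *v x))\<^sup>2 = (\<Sum>i\<in>UNIV. (norm (\<Sum>k\<in>UNIV. A $ i $ k * x $ k))\<^sup>2)"
    by (simp add: norm_vec_power2 matrix_vector_mult_def)
  also have "\<dots> \<le> (\<Sum>i\<in>UNIV. (\<Sum>k\<in>UNIV. (norm (A $ i $ k))\<^sup>2) * (\<Sum>k\<in>UNIV. (norm (x $ k))\<^sup>2))"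
    by (intro sum_mono norm_sum_mult_le_L2_set)
  also have "\<dots> = (norm A)\<^sup>2 * (norm x)\<^sup>2"
    by (simp add: norm_vec_power2 sum_distrib_right)
  finally show "(norm (A *v x))\<^sup>2 \<le> (norm A * norm x)\<^sup>2"
    by (simp add: power_mult_distrib)
qed simp

text \<open>This instance supplies the limit, derivative, continuity and series rules for
  \<open>**\<close> that a normed algebra would otherwise provide.\<close>

lemma bounded_bilinear_matrix_mult:
  "bounded_bilinear ((**) :: 'a::real_normed_field ^ 'n ^ 'm \<Rightarrow> 'a ^ 'p ^ 'n \<Rightarrow> 'a ^ 'p ^ 'm)"
proof
  show "(A + A') ** B = A ** B + A' ** B" for A A' :: "'a ^ 'n ^ 'm" and B :: "'a ^ 'p ^ 'n"
    by (simp add: matrix_matrix_mult_def vec_eq_iff distrib_right sum.distrib)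
  show "\<exists>K. \<forall>(A :: 'a ^ 'n ^ 'm) (B :: 'a ^ 'p ^ 'n). norm (A ** B) \<le> norm A * norm B * K"
    by (intro exI[of _ 1]) (simp add: norm_matrix_mult_le)
qed (simp_all add: matrix_add_ldistrib matrix_scalar_ac flip: scalar_matrix_assoc)

lemma bounded_bilinear_matrix_vector_mult:
  "bounded_bilinear ((*v) :: 'a::real_normed_field ^ 'n ^ 'm \<Rightarrow> 'a ^ 'n \<Rightarrow> 'a ^ 'm)"
proof
  show "\<exists>K. \<forall>(A :: 'a ^ 'n ^ 'm) x. norm (A *v x) \<le> norm A * norm x * K"
    by (intro exI[of _ 1]) (simp add: norm_matrix_vector_mult_le)
qed (simp_all add: matrix_vector_mult_def vec_eq_iff algebra_simps sum.distrib scaleR_sum_right)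

lemmas matrix_mult_diff_distribs =
  bounded_bilinear.diff_left[OF bounded_bilinear_matrix_mult]
  bounded_bilinear.diff_right[OF bounded_bilinear_matrix_mult]

lemma has_vector_derivative_matrix_mult:
  fixes F :: "real \<Rightarrow> 'a::real_normed_field ^ 'n ^ 'm" and G :: "real \<Rightarrow> 'a ^ 'p ^ 'n"
  assumes "(F has_vector_derivative F') (at t within S)" "(G has_vector_derivative G') (at t within S)"
  shows "((\<lambda>t. F t ** G t) has_vector_derivative F t ** G' + F' ** G t) (at t within S)"
  by (rule bounded_bilinear.has_vector_derivative[OF bounded_bilinear_matrix_mult assms])

lemma has_vector_derivative_matrixI:
  fixes F :: "real \<Rightarrow> real ^ 'n ^ 'm"
  assumes "\<And>i j. ((\<lambda>t. F t $ i $ j) has_real_derivative F' $ i $ j) (at t within S)"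
  shows "(F has_vector_derivative F') (at t within S)"
  using assms
  unfolding has_vector_derivative_def has_field_derivative_def
  by (subst has_derivative_componentwise_within)
    (auto simp: Basis_vec_def inner_axis mult_commute_abs)

section \<open>The exponential series and its group law\<close>

lemma matrix_power_scaleR:
  "((**) (t *\<^sub>R A) ^^ k) (mat 1) = t ^ k *\<^sub>R ((**) A ^^ k) (mat 1)"
  for A :: "real ^ 'n ^ 'n"
  by (induction k) (simp_all add: matrix_scalar_ac flip: scalar_matrix_assoc)

lemma matrix_power_commute:
  "((**) A ^^ k) (mat 1) ** A = A ** ((**) A ^^ k) (mat 1)"
  for A :: "real ^ 'n ^ 'n"
  by (induction k) (simp_all flip: matrix_mul_assoc)

lemma matrix_power_transpose:
  "((**) (transpose A) ^^ k) (mat 1) = transpose (((**) A ^^ k) (mat 1))"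
  for A :: "real ^ 'n ^ 'n"
  by (induction k) (simp_all add: matrix_transpose_mul[symmetric] matrix_power_commute)

lemma norm_matrix_power_le:
  "norm (((**) A ^^ k) (mat 1)) \<le> norm A ^ k * norm (mat 1 :: real ^ 'n ^ 'n)"
  for A :: "real ^ 'n ^ 'n"
proof (induction k)
  case (Suc k)
  then show ?case
    using norm_matrix_mult_le[of A "((**) A ^^ k) (mat 1)"]
      mult_left_mono[OF Suc.IH, of "norm A"]
    by (simp add: mult.assoc)
qed simp

lemma summable_matrix_exp:
  "summable (\<lambda>k. (1 / fact k) *\<^sub>R ((**) A ^^ k) (mat 1))"
  for A :: "real ^ 'n ^ 'n"
proof (rule summable_comparison_test'[where N = 0])
  show "summable (\<lambda>k. inverse (fact k) * norm A ^ k * norm (mat 1 :: real ^ 'n ^ 'n))"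
    by (intro summable_mult2 summable_exp)
  show "norm ((1 / fact k) *\<^sub>R ((**) A ^^ k) (mat 1))
      \<le> inverse (fact k) * norm A ^ k * norm (mat 1 :: real ^ 'n ^ 'n)" for k
    using mult_left_mono[OF norm_matrix_power_le[of k A], of "inverse (fact k)"]
    by (simp add: divide_inverse mult.assoc)
qed

lemma matrix_exp_sums:
  "(\<lambda>k. (t ^ k / fact k) *\<^sub>R ((**) A ^^ k) (mat 1)) sums matrix_exp (t *\<^sub>R A)"
  for A :: "real ^ 'n ^ 'n"
  using summable_sums[OF summable_matrix_exp[where A = "t *\<^sub>R A"]]
  by (simp add: matrix_exp_def matrix_power_scaleR)

text \<open>Multiplying the series by \<open>A\<close> termwise from either side gives the same
  terms, and a series has only one sum.\<close>

lemma matrix_exp_mult_commute: "matrix_exp (t *\<^sub>R A) ** A = A ** matrix_exp (t *\<^sub>R A)"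
  for A :: "real ^ 'n ^ 'n"
proof (rule sums_unique2)
  show "(\<lambda>k. (t ^ k / fact k) *\<^sub>R (((**) A ^^ k) (mat 1) ** A)) sums (matrix_exp (t *\<^sub>R A) ** A)"
    using bounded_linear.sums[OF bounded_bilinear.bounded_linear_left[OF
      bounded_bilinear_matrix_mult] matrix_exp_sums]
    by (simp flip: scalar_matrix_assoc)
  show "(\<lambda>k. (t ^ k / fact k) *\<^sub>R (((**) A ^^ k) (mat 1) ** A)) sums (A ** matrix_exp (t *\<^sub>R A))"
    using bounded_linear.sums[OF bounded_bilinear.bounded_linear_right[OF
      bounded_bilinear_matrix_mult] matrix_exp_sums]
    by (simp add: matrix_power_commute matrix_scalar_ac flip: scalar_matrix_assoc)
qed

lemma bounded_linear_transpose: "bounded_linear (transpose :: real ^ 'n ^ 'm \<Rightarrow> real ^ 'm ^ 'n)"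
  unfolding linear_conv_bounded_linear[symmetric]
  by (rule linearI) (simp_all add: transpose_def vec_eq_iff)

lemma matrix_exp_transpose: "matrix_exp (t *\<^sub>R transpose A) = transpose (matrix_exp (t *\<^sub>R A))"
  for A :: "real ^ 'n ^ 'n"
proof (rule sums_unique2[OF matrix_exp_sums])
  show "(\<lambda>k. (t ^ k / fact k) *\<^sub>R ((**) (transpose A) ^^ k) (mat 1))
      sums transpose (matrix_exp (t *\<^sub>R A))"
    using bounded_linear.sums[OF bounded_linear_transpose matrix_exp_sums]
    by (simp add: matrix_power_transpose transpose_scalar)
qed

lemma matrix_exp_0 [simp]: "matrix_exp 0 = (mat 1 :: real ^ 'n ^ 'n)"
proof (rule sums_unique2)
  show "(\<lambda>k. (0 ^ k / fact k) *\<^sub>R ((**) (0 :: real ^ 'n ^ 'n) ^^ k) (mat 1)) sums matrix_exp 0"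
    using matrix_exp_sums[of 0 0] by simp
  show "(\<lambda>k. (0 ^ k / fact k) *\<^sub>R ((**) (0 :: real ^ 'n ^ 'n) ^^ k) (mat 1)) sums mat 1"
    by (rule sums_cong[THEN iffD1, OF _ sums_single[of 0 "\<lambda>_. mat 1"]]) simp
qed

text \<open>Every entry of the exponential is a scalar power series in \<open>t\<close> that
  converges everywhere, so the real theorem on termwise differentiation applies entry by
  entry.\<close>

lemma matrix_exp_has_vector_derivative:
  "((\<lambda>t. matrix_exp (t *\<^sub>R A)) has_vector_derivative A ** matrix_exp (t *\<^sub>R A)) (at t within S)"
  for A :: "real ^ 'n ^ 'n"
proof (rule has_vector_derivative_matrixI)
  fix i j
  define c where "c k = ((**) A ^^ k) (mat 1) $ i $ j / fact k" for k
  have entry: "(\<lambda>k. c k * t ^ k) sums (matrix_exp (t *\<^sub>R A) $ i $ j)" for t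
    using bounded_linear.sums[OF bounded_linear_vec_nth bounded_linear.sums[OF
      bounded_linear_vec_nth matrix_exp_sums[of t A]], of i j]
    by (simp add: c_def mult.commute)
  have "(\<lambda>k. diffs c k * t ^ k) sums ((A ** matrix_exp (t *\<^sub>R A)) $ i $ j)"
  proof -
    have "(\<lambda>k. (A ** ((t ^ k / fact k) *\<^sub>R ((**) A ^^ k) (mat 1))) $ i $ j)
        sums ((A ** matrix_exp (t *\<^sub>R A)) $ i $ j)"
      by (intro bounded_linear.sums[OF bounded_linear_vec_nth]
        bounded_linear.sums[OF bounded_bilinear.bounded_linear_right[OF
          bounded_bilinear_matrix_mult]] matrix_exp_sums)
    \<comment> \<open>The factor \<open>k + 1\<close> of the formal derivative cancels against
      \<open>fact (Suc k)\<close>, leaving the next matrix power over \<open>fact k\<close>;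
      \<open>of_nat (Suc k)\<close> has to stay unexpanded for this.\<close>
    moreover have "diffs c k = (A ** ((**) A ^^ k) (mat 1)) $ i $ j / fact k" for k
      by (simp add: c_def diffs_def del: of_nat_Suc)
    ultimately show ?thesis
      by (simp add: matrix_scalar_ac mult.commute flip: scalar_matrix_assoc)
  qed
  moreover have "((\<lambda>t. \<Sum>k. c k * t ^ k) has_real_derivative (\<Sum>k. diffs c k * t ^ k)) (at t)"
    by (rule termdiffs_strong_converges_everywhere) (rule sums_summable[OF entry])
  ultimately have "((\<lambda>t. matrix_exp (t *\<^sub>R A) $ i $ j) has_real_derivative
      (A ** matrix_exp (t *\<^sub>R A)) $ i $ j) (at t)"
    by (simp add: sums_iff sums_unique[OF entry, symmetric])
  then show "((\<lambda>t. matrix_exp (t *\<^sub>R A) $ i $ j) has_real_derivative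
      (A ** matrix_exp (t *\<^sub>R A)) $ i $ j) (at t within S)"
    by (rule DERIV_subset) simp
qed

text \<open>Integrating factor: as \<open>A\<close> commutes with its exponential, the two terms of
  the product derivative cancel, so the product keeps its value at \<open>t = 0\<close>.\<close>

lemma matrix_exp_ode_unique:
  fixes X :: "real \<Rightarrow> real ^ 'n ^ 'n"
  assumes X: "\<And>t. (X has_vector_derivative A ** X t) (at t)"
  shows "matrix_exp (- t *\<^sub>R A) ** X t = X 0"
proof -
  have minus: "((\<lambda>t. matrix_exp (- t *\<^sub>R A)) has_vector_derivative - (A ** matrix_exp (- t *\<^sub>R A)))
      (at t)" for t
    using vector_diff_chain_at[OF has_vector_derivative_minus[OF has_vector_derivative_id]
      matrix_exp_has_vector_derivative[where A = A], of t]
    by (simp add: o_def)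
  have "((\<lambda>t. matrix_exp (- t *\<^sub>R A) ** X t) has_vector_derivative 0) (at t)" for t
    using has_vector_derivative_matrix_mult[OF minus[of t] X[of t]]
    by (simp add: matrix_mul_assoc matrix_exp_mult_commute[of "- t", symmetric]
      bounded_bilinear.minus_left[OF bounded_bilinear_matrix_mult] del: scaleR_minus_left)
  then show ?thesis
    using has_derivative_zero_unique[of UNIV "\<lambda>t. matrix_exp (- t *\<^sub>R A) ** X t" t 0]
    by (simp add: has_vector_derivative_def)
qed

lemma matrix_exp_minus_mult: "matrix_exp (- t *\<^sub>R A) ** matrix_exp (t *\<^sub>R A) = mat 1"
  for A :: "real ^ 'n ^ 'n"
  using matrix_exp_ode_unique[OF matrix_exp_has_vector_derivative[where A = A], of t] by simp

text \<open>As a function of \<open>s\<close>, the left side solves the linear equation with initial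
  value \<open>matrix_exp (t *\<^sub>R A)\<close>. Uniqueness gives the claim up to the factor for
  \<open>- s\<close>, which is then inverted.\<close>

lemma matrix_exp_add: "matrix_exp ((s + t) *\<^sub>R A) = matrix_exp (s *\<^sub>R A) ** matrix_exp (t *\<^sub>R A)"
  for A :: "real ^ 'n ^ 'n"
proof -
  have "((\<lambda>s. matrix_exp ((s + t) *\<^sub>R A)) has_vector_derivative A ** matrix_exp ((s + t) *\<^sub>R A))
      (at s)" for s
    using vector_diff_chain_at[OF has_vector_derivative_add[OF has_vector_derivative_id
      has_vector_derivative_const[of t]] matrix_exp_has_vector_derivative[where A = A], of s]
    by (simp add: o_def)
  from matrix_exp_ode_unique[OF this, of s]
  have "matrix_exp (- s *\<^sub>R A) ** matrix_exp ((s + t) *\<^sub>R A) = matrix_exp (t *\<^sub>R A)"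
    by simp
  then have "(matrix_exp (s *\<^sub>R A) ** matrix_exp (- s *\<^sub>R A)) ** matrix_exp ((s + t) *\<^sub>R A)
      = matrix_exp (s *\<^sub>R A) ** matrix_exp (t *\<^sub>R A)"
    by (metis matrix_mul_assoc)
  then show ?thesis
    using matrix_exp_minus_mult[of "- s" A] by simp
qed

subsection \<open>Exponential decay of the transient and the Gramians\<close>

context
  fixes A :: "real ^ 'n ^ 'n"
  assumes semistable: "semistable A"
begin

text \<open>The columns of the exponential are trajectories started at the unit vectors, so
  semistability makes each of them converge. This turns the \<open>Lim\<close> in
  \<open>exp_limit\<close> into an actual limit.\<close>

lemma semistable_tendsto: "((\<lambda>t. matrix_exp (t *\<^sub>R A)) \<longlongrightarrow> exp_limit A) at_top"
proof -
  have "\<exists>l. ((\<lambda>t. matrix_exp (t *\<^sub>R A) *v axis j 1) \<longlongrightarrow> l) at_top" for j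
  proof -
    have "((\<lambda>t. matrix_exp (t *\<^sub>R A) *v axis j 1) has_vector_derivative
        A *v (matrix_exp (t *\<^sub>R A) *v axis j 1)) (at t within {0..})" for t
      using bounded_linear.has_vector_derivative[OF bounded_bilinear.bounded_linear_left[OF
        bounded_bilinear_matrix_vector_mult] matrix_exp_has_vector_derivative]
      by (simp add: matrix_vector_mul_assoc)
    then show ?thesis
      using semistable unfolding semistable_def by blast
  qed
  then obtain l where l: "((\<lambda>t. matrix_exp (t *\<^sub>R A) *v axis j 1) \<longlongrightarrow> l j) at_top" for j
    by metis
  have "((\<lambda>t. matrix_exp (t *\<^sub>R A)) \<longlongrightarrow> (\<chi> i j. l j $ i)) at_top"
  proof (intro vec_tendstoI)
    fix i j
    show "((\<lambda>t. matrix_exp (t *\<^sub>R A) $ i $ j) \<longlongrightarrow> (\<chi> i j. l j $ i) $ i $ j) at_top"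
      using tendsto_vec_nth[OF l[of j], of i]
      by (simp add: matrix_vector_mult_basis column_def)
  qed
  then show ?thesis
    unfolding exp_limit_def by (subst tendsto_Lim) auto
qed

text \<open>The exponential at time \<open>s + t\<close> has two descriptions of its limit as
  \<open>t\<close> grows: by the group law, and by a mere shift of time.\<close>

lemma matrix_exp_mult_exp_limit: "matrix_exp (s *\<^sub>R A) ** exp_limit A = exp_limit A"
proof (rule tendsto_unique)
  show "((\<lambda>t. matrix_exp ((s + t) *\<^sub>R A)) \<longlongrightarrow> matrix_exp (s *\<^sub>R A) ** exp_limit A) at_top"
    unfolding matrix_exp_add
    by (intro bounded_bilinear.tendsto[OF bounded_bilinear_matrix_mult] tendsto_const
      semistable_tendsto)
  show "((\<lambda>t. matrix_exp ((s + t) *\<^sub>R A)) \<longlongrightarrow> exp_limit A) at_top"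
    by (rule filterlim_compose[OF semistable_tendsto filterlim_tendsto_add_at_top])
      (auto intro: filterlim_ident)
qed simp

lemma exp_limit_mult_matrix_exp: "exp_limit A ** matrix_exp (s *\<^sub>R A) = exp_limit A"
proof (rule tendsto_unique)
  show "((\<lambda>t. matrix_exp ((s + t) *\<^sub>R A)) \<longlongrightarrow> exp_limit A ** matrix_exp (s *\<^sub>R A)) at_top"
    unfolding matrix_exp_add add.commute[of s]
    by (intro bounded_bilinear.tendsto[OF bounded_bilinear_matrix_mult] tendsto_const
      semistable_tendsto)
  show "((\<lambda>t. matrix_exp ((s + t) *\<^sub>R A)) \<longlongrightarrow> exp_limit A) at_top"
    by (rule filterlim_compose[OF semistable_tendsto filterlim_tendsto_add_at_top])
      (auto intro: filterlim_ident)
qed simp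

lemma exp_limit_idem: "exp_limit A ** exp_limit A = exp_limit A"
proof (rule tendsto_unique)
  show "((\<lambda>t. matrix_exp (t *\<^sub>R A) ** exp_limit A) \<longlongrightarrow> exp_limit A ** exp_limit A) at_top"
    by (intro bounded_bilinear.tendsto[OF bounded_bilinear_matrix_mult] tendsto_const
      semistable_tendsto)
  show "((\<lambda>t. matrix_exp (t *\<^sub>R A) ** exp_limit A) \<longlongrightarrow> exp_limit A) at_top"
    by (simp add: matrix_exp_mult_exp_limit)
qed simp

text \<open>By \<open>matrix_exp_mult_exp_limit\<close> the function differentiated here is
  constant, while its derivative at 0 is the product in question.\<close>

lemma mult_exp_limit: "A ** exp_limit A = 0"
proof -
  have "((\<lambda>t. matrix_exp (t *\<^sub>R A) ** exp_limit A) has_vector_derivative A ** exp_limit A) (at 0)"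
    using has_vector_derivative_matrix_mult[OF matrix_exp_has_vector_derivative[of A 0]
      has_vector_derivative_const]
    by simp
  then show ?thesis
    by (simp add: matrix_exp_mult_exp_limit vector_derivative_unique_at[OF _ has_vector_derivative_const])
qed

lemma exp_limit_mult: "exp_limit A ** A = 0"
proof -
  have "((\<lambda>t. exp_limit A ** matrix_exp (t *\<^sub>R A)) has_vector_derivative exp_limit A ** A) (at 0)"
    using has_vector_derivative_matrix_mult[OF has_vector_derivative_const
      matrix_exp_has_vector_derivative[of A 0]]
    by simp
  then show ?thesis
    by (simp add: exp_limit_mult_matrix_exp vector_derivative_unique_at[OF _ has_vector_derivative_const])
qed

text \<open>In the expanded product, the two mixed terms and the square of
  \<open>exp_limit A\<close> are all equal to \<open>exp_limit A\<close>, so exactly one copy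
  remains subtracted.\<close>

lemma transient_add:
  "matrix_exp ((s + t) *\<^sub>R A) - exp_limit A
    = (matrix_exp (s *\<^sub>R A) - exp_limit A) ** (matrix_exp (t *\<^sub>R A) - exp_limit A)"
  by (simp add: matrix_mult_diff_distribs matrix_exp_add matrix_exp_mult_exp_limit
    exp_limit_mult_matrix_exp exp_limit_idem)

lemma transient_has_vector_derivative:
  "((\<lambda>t. matrix_exp (t *\<^sub>R A) - exp_limit A) has_vector_derivative
    (matrix_exp (t *\<^sub>R A) - exp_limit A) ** A) (at t within S)"
  using has_vector_derivative_diff[OF matrix_exp_has_vector_derivative has_vector_derivative_const]
  by (simp add: matrix_mult_diff_distribs exp_limit_mult matrix_exp_mult_commute)

lemma continuous_on_transient: "continuous_on S (\<lambda>t. matrix_exp (t *\<^sub>R A) - exp_limit A)"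
  using transient_has_vector_derivative
  by (intro continuous_on_vector_derivative) blast

lemma transient_exponential_decay:
  obtains M a where "a > 0" "M \<ge> 0"
    "\<And>t. t \<ge> 0 \<Longrightarrow> norm (matrix_exp (t *\<^sub>R A) - exp_limit A) \<le> M * exp (- a * t)"
proof -
  define D where "D t = matrix_exp (t *\<^sub>R A) - exp_limit A" for t
  have "(D \<longlongrightarrow> 0) at_top"
    using semistable_tendsto unfolding D_def by (simp add: LIM_zero)
  then have "\<forall>\<^sub>F t in at_top. norm (D t) < exp (- 1)"
    \<comment> \<open>With the threshold \<open>exp (- 1)\<close> at time \<open>T\<close>, each
      further period of length \<open>T\<close> gains a factor \<open>exp (- 1)\<close>; this
      produces the decay rate \<open>1 / T\<close>.\<close>
    using order_tendstoD(2)[OF tendsto_norm_zero] by (metis exp_gt_zero)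
  then obtain T where T: "T > 0" "norm (D T) < exp (- 1)"
    using eventually_conj[OF eventually_gt_at_top[of 0]] by (metis (mono_tags, lifting) eventually_happens' trivial_limit_at_top_linorder)
  have "bounded (D ` {0..T})"
    unfolding D_def by (intro compact_imp_bounded compact_continuous_image continuous_on_transient) simp
  then obtain N where N: "N > 0" "\<And>t. 0 \<le> t \<Longrightarrow> t \<le> T \<Longrightarrow> norm (D t) \<le> N"
    unfolding bounded_pos by auto
  have step: "norm (D (real n * T + r)) \<le> exp (- real n) * N" if "0 \<le> r" "r \<le> T" for n r
  proof (induction n)
    case 0
    then show ?case using N that by simp
  next
    case (Suc n)
    have "D (real (Suc n) * T + r) = D T ** D (real n * T + r)"
      unfolding D_def by (simp flip: transient_add) (simp add: algebra_simps)
    then have "norm (D (real (Suc n) * T + r)) \<le> norm (D T) * norm (D (real n * T + r))"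
      by (simp add: norm_matrix_mult_le)
    also have "\<dots> \<le> exp (- 1) * (exp (- real n) * N)"
      using T Suc by (intro mult_mono) auto
    also have "\<dots> = exp (- real (Suc n)) * N"
      by (simp add: exp_add[symmetric] mult.assoc[symmetric])
    finally show ?case .
  qed
  show thesis
  proof
    show "1 / T > 0" "N * exp 1 \<ge> 0" using T N by auto
    fix t :: real assume t: "t \<ge> 0"
    \<comment> \<open>Number of full periods before \<open>t\<close>. Since \<open>n\<close> is at
      least \<open>t / T - 1\<close>, rounding down costs the factor \<open>exp 1\<close> in the
      constant.\<close>
    define n where "n = nat \<lfloor>t / T\<rfloor>"
    have n: "real n \<le> t / T" "t / T \<le> real n + 1"
      using t T by (auto simp: n_def)
    have "norm (D t) \<le> exp (- real n) * N"
      using step[of "t - real n * T" n] n T by (simp add: field_simps)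
    also have "\<dots> \<le> exp (1 - t / T) * N"
      using n N by (intro mult_right_mono) auto
    also have "\<dots> = N * exp 1 * exp (- (1 / T) * t)"
      by (simp add: exp_diff exp_minus divide_inverse mult_ac)
    finally show "norm (matrix_exp (t *\<^sub>R A) - exp_limit A) \<le> N * exp 1 * exp (- (1 / T) * t)"
      by (simp add: D_def)
  qed
qed

end

section \<open>Integrals of exponentially decaying functions and the trace formulas\<close>

lemma integrable_on_exponential_decay:
  fixes f :: "real \<Rightarrow> 'b::euclidean_space"
  assumes "continuous_on {0..} f" "a > 0"
    and "\<And>t. t \<ge> 0 \<Longrightarrow> norm (f t) \<le> M * exp (- a * t)"
  shows "f integrable_on {0..}"
proof (rule measurable_bounded_by_integrable_imp_integrable)
  show "(\<lambda>t. M * exp (- a * t)) integrable_on {0..}"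
    using integrable_on_exp_minus_to_infinity[OF \<open>a > 0\<close>, of 0]
    by (rule integrable_on_mult_right)
  show "f \<in> borel_measurable (lebesgue_on {0..})"
    by (rule continuous_imp_measurable_on_sets_lebesgue[OF assms(1)]) simp
qed (use assms in auto)

lemma trace_matrix_mult_transpose: "trace (transpose M ** M) = (norm M)\<^sup>2"
  for M :: "real ^ 'n ^ 'm"
  by (simp add: trace_def matrix_matrix_mult_def transpose_def norm_vec_power2)
    (subst sum.swap, simp add: power2_eq_square)

lemma bounded_linear_trace: "bounded_linear (trace :: real ^ 'n ^ 'n \<Rightarrow> real)"
  unfolding linear_conv_bounded_linear[symmetric]
  by (rule linearI) (simp_all add: trace_def sum.distrib sum_distrib_left)

lemma bounded_linear_sandwich:
  "bounded_linear (\<lambda>X. L ** X ** R)"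
  for L :: "real ^ 'n ^ 'm" and R :: "real ^ 'q ^ 'p"
  by (rule bounded_linear_compose[OF bounded_bilinear.bounded_linear_left[OF
    bounded_bilinear_matrix_mult] bounded_bilinear.bounded_linear_right[OF
    bounded_bilinear_matrix_mult]])

lemma trace_sandwich_integral:
  fixes L :: "real ^ 'n ^ 'm" and R :: "real ^ 'm ^ 'p"
  assumes "F integrable_on S"
  shows "trace (L ** integral S F ** R) = integral S (\<lambda>t. trace (L ** F t ** R))"
  using integral_linear[OF assms bounded_linear_compose[OF bounded_linear_trace
    bounded_linear_sandwich[of L R]]]
  by (simp add: o_def)

lemma norm_transpose: "norm (transpose M) = norm M"
  for M :: "real ^ 'n ^ 'm"
proof -
  have "(norm (transpose M))\<^sup>2 = (norm M)\<^sup>2"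
    by (simp add: norm_vec_power2 transpose_def) (rule sum.swap)
  then show ?thesis by simp
qed

text \<open>The rates add up to \<open>2 * a\<close> and the constants multiply. A common
  \<open>M\<close> and \<open>a\<close> suffice because one factor will be the transpose of the
  other, which has the same Frobenius norm.\<close>

lemma integrable_on_exponential_decay_product:
  fixes F :: "real \<Rightarrow> real ^ 'n ^ 'm" and G :: "real \<Rightarrow> real ^ 'q ^ 'p"
  assumes cont: "continuous_on {0..} F" "continuous_on {0..} G" and "a > 0"
    and F: "\<And>t. t \<ge> 0 \<Longrightarrow> norm (F t) \<le> M * exp (- a * t)"
    and G: "\<And>t. t \<ge> 0 \<Longrightarrow> norm (G t) \<le> M * exp (- a * t)"
  shows "(\<lambda>t. F t ** K ** G t) integrable_on {0..}"
proof (rule integrable_on_exponential_decay)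
  show "continuous_on {0..} (\<lambda>t. F t ** K ** G t)"
    by (intro bounded_bilinear.continuous_on[OF bounded_bilinear_matrix_mult] cont
      continuous_on_const)
  show "2 * a > 0" using \<open>a > 0\<close> by simp
  fix t :: real assume "t \<ge> 0"
  have "norm (F t ** K ** G t) \<le> norm (F t) * norm K * norm (G t)"
    by (rule order_trans[OF norm_matrix_mult_le]) (simp add: mult_right_mono norm_matrix_mult_le)
  also have "\<dots> = norm K * (norm (F t) * norm (G t))"
    by simp
  also have "\<dots> \<le> norm K * ((M * exp (- a * t)) * (M * exp (- a * t)))"
    using F[OF \<open>t \<ge> 0\<close>] G[OF \<open>t \<ge> 0\<close>]
    by (intro mult_left_mono mult_mono) (auto intro: order_trans[OF norm_ge_zero])
  also have "\<dots> = norm K * M\<^sup>2 * exp (- (2 * a) * t)"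
    by (simp add: power2_eq_square mult_ac flip: exp_add)
  finally show "norm (F t ** K ** G t) \<le> norm K * M\<^sup>2 * exp (- (2 * a) * t)" .
qed

text \<open>The condition \<open>CJB\<close> removes the limit part of the impulse response: the
  exponential in it may be replaced by the decaying transient, which is what the Gramians
  integrate.\<close>

lemma H2_norm_power2:
  fixes A :: "real ^ 'n ^ 'n" and B :: "real ^ 'p ^ 'n" and C :: "real ^ 'n ^ 'q"
  assumes semistable: "semistable A" and CJB: "C ** exp_limit A ** B = 0"
  shows "(H2_norm A B C)\<^sup>2 = trace (C ** ctrl_gramian A B ** transpose C)"
    and "(H2_norm A B C)\<^sup>2 = trace (transpose B ** obs_gramian A C ** B)"
proof -
  define D where "D t = matrix_exp (t *\<^sub>R A) - exp_limit A" for t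
  define g where "g t = C ** D t ** B" for t
  have transpose_D: "matrix_exp (t *\<^sub>R transpose A) - transpose (exp_limit A) = transpose (D t)" for t
    by (simp add: D_def matrix_exp_transpose linear_diff[OF
      bounded_linear.linear[OF bounded_linear_transpose]])
  have impulse: "impulse_response A B C = g"
    by (simp add: fun_eq_iff impulse_response_def g_def D_def matrix_mult_diff_distribs CJB)
  have ctrl: "ctrl_gramian A B = integral {0..} (\<lambda>t. D t ** (B ** transpose B) ** transpose (D t))"
    unfolding ctrl_gramian_def transpose_D D_def[symmetric] by (simp add: matrix_mul_assoc)
  have obs: "obs_gramian A C = integral {0..} (\<lambda>t. transpose (D t) ** (transpose C ** C) ** D t)"
    unfolding obs_gramian_def transpose_D D_def[symmetric] by (simp add: matrix_mul_assoc)
  obtain M a where Ma: "a > 0" "\<And>t. t \<ge> 0 \<Longrightarrow> norm (D t) \<le> M * exp (- a * t)"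
    using transient_exponential_decay[OF semistable] unfolding D_def by metis
  have cont: "continuous_on {0..} D"
    unfolding D_def by (rule continuous_on_transient[OF semistable])
  have cont_transpose: "continuous_on {0..} (\<lambda>t. transpose (D t))"
    by (rule bounded_linear.continuous_on[OF bounded_linear_transpose cont])
  have int_ctrl: "(\<lambda>t. D t ** (B ** transpose B) ** transpose (D t)) integrable_on {0..}"
    using Ma by (intro integrable_on_exponential_decay_product[OF cont cont_transpose])
      (auto simp: norm_transpose)
  have int_obs: "(\<lambda>t. transpose (D t) ** (transpose C ** C) ** D t) integrable_on {0..}"
    using Ma by (intro integrable_on_exponential_decay_product[OF cont_transpose cont])
      (auto simp: norm_transpose)
  have g_obs: "transpose (g t) ** g t
      = transpose B ** (transpose (D t) ** (transpose C ** C) ** D t) ** B" for t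
    by (simp add: g_def matrix_transpose_mul matrix_mul_assoc)
  have g_ctrl: "g t ** transpose (g t)
      = C ** (D t ** (B ** transpose B) ** transpose (D t)) ** transpose C" for t
    by (simp add: g_def matrix_transpose_mul matrix_mul_assoc)
  have int_g: "(\<lambda>t. transpose (g t) ** g t) integrable_on {0..}"
    unfolding g_obs using integrable_linear[OF int_obs bounded_linear_sandwich] by (simp add: o_def)
  have trace_g: "trace (integral {0..} (\<lambda>t. transpose (g t) ** g t))
      = integral {0..} (\<lambda>t. trace (transpose (g t) ** g t))"
    using trace_sandwich_integral[OF int_g, of "mat 1" "mat 1"] by simp
  \<comment> \<open>\<open>H2_norm\<close> is a square root; squaring recovers the trace only once
    the trace is known to be nonnegative.\<close>
  have "0 \<le> trace (integral {0..} (\<lambda>t. transpose (g t) ** g t))"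
    unfolding trace_g trace_matrix_mult_transpose
    using integrable_linear[OF int_g bounded_linear_trace]
    by (intro integral_nonneg) (simp_all add: o_def trace_matrix_mult_transpose)
  then have H2: "(H2_norm A B C)\<^sup>2 = integral {0..} (\<lambda>t. trace (transpose (g t) ** g t))"
    by (simp add: H2_norm_def impulse trace_g)
  show "(H2_norm A B C)\<^sup>2 = trace (transpose B ** obs_gramian A C ** B)"
    unfolding H2 obs trace_sandwich_integral[OF int_obs] g_obs ..
  show "(H2_norm A B C)\<^sup>2 = trace (C ** ctrl_gramian A B ** transpose C)"
    unfolding H2 ctrl trace_sandwich_integral[OF int_ctrl] g_ctrl[symmetric]
    by (intro integral_cong trace_mul_sym)
qed

subsection \<open>The resolvent\<close>

abbreviation cmat :: "real ^ 'n ^ 'm \<Rightarrow> complex ^ 'n ^ 'm"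
  where "cmat \<equiv> map_matrix of_real"

section \<open>Complexified matrices and scalar matrices\<close>

lemma norm_cmat: "norm (cmat M) = norm M"
  by (simp add: norm_vec_def)

lemma bounded_linear_cmat: "bounded_linear (cmat :: real ^ 'n ^ 'm \<Rightarrow> complex ^ 'n ^ 'm)"
  unfolding linear_conv_bounded_linear[symmetric]
  by (rule linearI) (simp_all add: vec_eq_iff scaleR_conv_of_real[where 'a = complex])

lemma cmat_mult: "cmat (M ** N) = cmat M ** cmat N"
  by (simp add: vec_eq_iff matrix_matrix_mult_def)

lemma cmat_mat: "cmat (mat c) = mat (of_real c)"
  by (simp add: vec_eq_iff mat_def)

lemma cmat_diff: "cmat (M - N) = cmat M - cmat N"
  by (rule linear_diff[OF bounded_linear.linear[OF bounded_linear_cmat]])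

lemma cmat_eq_0_iff: "cmat M = 0 \<longleftrightarrow> M = 0"
  by (simp add: vec_eq_iff)

lemma mat_mult_component: "(mat c ** M) $ i $ j = c * M $ i $ j"
  for M :: "'a::semiring_1 ^ 'n ^ 'm"
  by (simp add: matrix_matrix_mult_def mat_def if_distrib if_distribR cong: if_cong)

lemma mult_mat_component: "(M ** mat c) $ i $ j = M $ i $ j * c"
  for M :: "'a::semiring_1 ^ 'n ^ 'm"
  by (simp add: matrix_matrix_mult_def mat_def if_distrib if_distribR cong: if_cong)

lemma mat_mult_commute: "mat c ** M = M ** mat c"
  for M :: "'a::comm_semiring_1 ^ 'n ^ 'm"
  by (simp add: vec_eq_iff mat_mult_component mult_mat_component mult.commute)

lemma mult_mat_mult: "M ** (mat c ** N) = mat c ** (M ** N)"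
  for M :: "'a::comm_semiring_1 ^ 'n ^ 'm"
  by (metis matrix_mul_assoc mat_mult_commute)

lemma matrix_vector_mult_axis: "(M *v axis j 1) $ i = M $ i $ j"
  for M :: "'a::semiring_1 ^ 'n ^ 'm"
  by (simp add: matrix_vector_mult_def axis_def if_distrib cong: if_cong)

lemma norm_mat_mult: "norm (mat c ** M) = norm c * norm M"
  for M :: "'a::real_normed_field ^ 'n ^ 'm"
proof -
  have "(norm (mat c ** M))\<^sup>2 = (norm c * norm M)\<^sup>2"
    by (simp add: norm_vec_power2 mat_mult_component norm_mult power_mult_distrib sum_distrib_left)
  then show ?thesis
    by (simp add: power2_eq_iff_nonneg)
qed

lemma bounded_linear_mat: "bounded_linear (mat :: complex \<Rightarrow> complex ^ 'n ^ 'n)"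
  unfolding linear_conv_bounded_linear[symmetric]
  by (rule linearI) (simp_all add: vec_eq_iff mat_def)

text \<open>Bounding the derivative of \<open>exp (- s t) (exp (A t) - J) X\<close>, which is
  \<open>- exp (- s t) (exp (A t) - J) (s I - A) X\<close>, yields a resolvent estimate up to the imaginary axis
  without an improper integral.\<close>

lemma resolvent_bound:
  fixes A :: "real ^ 'n ^ 'n"
  assumes semistable: "semistable A"
  obtains K where "\<And>s (X :: complex ^ 'm ^ 'n). Re s \<ge> 0 \<Longrightarrow>
    norm ((mat 1 - cmat (exp_limit A)) ** X) \<le> K * norm ((mat s - cmat A) ** X)"
proof -
  define D where "D t = matrix_exp (t *\<^sub>R A) - exp_limit A" for t
  obtain M a where a: "a > 0" and "M \<ge> 0"
    and M: "\<And>t. t \<ge> 0 \<Longrightarrow> norm (D t) \<le> M * exp (- a * t)"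
    using transient_exponential_decay[OF semistable] unfolding D_def by metis
  have "norm ((mat 1 - cmat (exp_limit A)) ** X) \<le> M / a * norm ((mat s - cmat A) ** X)"
    if s: "Re s \<ge> 0" for s and X :: "complex ^ 'm ^ 'n"
  proof -
    \<comment> \<open>The combination that appears when \<open>h\<close> is differentiated: the
      exponential contributes \<open>- s\<close> and the transient contributes \<open>A\<close> on
      its right, next to \<open>X\<close>.\<close>
    define U where "U = (mat s - cmat A) ** X"
    define h where "h t = mat (exp (- s * of_real t)) ** (cmat (D t) ** X)" for t
    define h' where "h' t = - (mat (exp (- s * of_real t)) ** (cmat (D t) ** U))" for t
    have norm_h: "norm (mat (exp (- s * of_real t)) ** (cmat (D t) ** Y)) \<le> M * exp (- a * t) * norm Y"
      if "t \<ge> 0" for t and Y :: "complex ^ 'm ^ 'n"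
    proof -
      have "norm (mat (exp (- s * of_real t)) ** (cmat (D t) ** Y))
          = exp (- Re s * t) * norm (cmat (D t) ** Y)"
        by (simp add: norm_mat_mult)
      also have "\<dots> \<le> 1 * (norm (D t) * norm Y)"
        using s that norm_matrix_mult_le[of "cmat (D t)" Y]
        by (intro mult_mono) (auto simp: norm_cmat)
      also have "\<dots> \<le> M * exp (- a * t) * norm Y"
        using M[OF that] by (simp add: mult_right_mono)
      finally show ?thesis .
    qed
    have deriv: "(h has_vector_derivative h' t) (at t)" for t
    proof -
      have "((\<lambda>t. exp (- s * of_real t)) has_vector_derivative - s * exp (- s * of_real t)) (at t)"
        by (rule has_vector_derivative_eq_rhs, rule has_vector_derivative_real_field)
          (auto intro!: derivative_eq_intros)
      from bounded_linear.has_vector_derivative[OF bounded_linear_mat this]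
      have e: "((\<lambda>t. mat (exp (- s * of_real t))) has_vector_derivative
          (mat (- s * exp (- s * of_real t)) :: complex ^ 'n ^ 'n)) (at t)" .
      have "((\<lambda>t. cmat (D t) ** X) has_vector_derivative cmat (D t ** A) ** X) (at t)"
        unfolding D_def
        by (intro bounded_linear.has_vector_derivative[OF
          bounded_bilinear.bounded_linear_left[OF bounded_bilinear_matrix_mult]]
          bounded_linear.has_vector_derivative[OF bounded_linear_cmat]
          transient_has_vector_derivative[OF semistable])
      from has_vector_derivative_matrix_mult[OF e this]
      have "(h has_vector_derivative mat (exp (- s * of_real t)) ** (cmat (D t ** A) ** X)
          + mat (- s * exp (- s * of_real t)) ** (cmat (D t) ** X)) (at t)"
        unfolding h_def .
      moreover have "mat (exp (- s * of_real t)) ** (cmat (D t ** A) ** X)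
          + mat (- s * exp (- s * of_real t)) ** (cmat (D t) ** X) = h' t"
      proof -
        have "cmat (D t) ** U = mat s ** (cmat (D t) ** X) - cmat (D t ** A) ** X"
          by (simp add: U_def matrix_mult_diff_distribs cmat_mult mult_mat_mult)
              (simp add: matrix_mul_assoc)
        then show ?thesis
          unfolding h'_def by (simp add: vec_eq_iff mat_mult_component right_diff_distrib)
      qed
      ultimately show ?thesis by simp
    qed
    have bound: "norm (h 0) \<le> M / a * norm U + M * norm X * exp (- a * T)" if "T > 0" for T
    proof -
      \<comment> \<open>An antiderivative of the bound on \<open>norm (h' t)\<close>. Its increment
        over \<open>{0..T}\<close> is at most \<open>M / a * norm U\<close>, uniformly in
        \<open>T\<close>.\<close>
      define \<phi> where "\<phi> t = - (M / a * norm U * exp (- a * t))" for t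
      have \<phi>: "(\<phi> has_vector_derivative M * exp (- a * t) * norm U) (at t)" for t
        unfolding \<phi>_def has_real_derivative_iff_has_vector_derivative[symmetric]
        using a by (auto intro!: derivative_eq_intros)
      have "norm (h T - h 0) \<le> \<phi> T - \<phi> 0"
      proof (rule differentiable_bound_general[OF \<open>T > 0\<close> _ _ deriv \<phi>])
        show "continuous_on {0..T} h"
          using deriv by (intro continuous_on_vector_derivative) (blast intro: has_vector_derivative_at_within)
        show "continuous_on {0..T} \<phi>"
          using \<phi> by (intro continuous_on_vector_derivative) (blast intro: has_vector_derivative_at_within)
        show "norm (h' t) \<le> M * exp (- a * t) * norm U" if "0 < t" for t
          using norm_h[of t U] that by (simp add: h'_def)
      qed
      also have "\<phi> T - \<phi> 0 \<le> M / a * norm U"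
        using a \<open>M \<ge> 0\<close> by (simp add: \<phi>_def)
      finally have "norm (h T - h 0) \<le> M / a * norm U" .
      moreover have "norm (h T) \<le> M * norm X * exp (- a * T)"
        using norm_h[of T X] that by (simp add: h_def mult_ac)
      ultimately show ?thesis
        using norm_triangle_ineq2[of "h 0" "h T"] by (simp add: norm_minus_commute)
    qed
    \<comment> \<open>Letting \<open>T\<close> tend to infinity removes the boundary term. The value
      \<open>h 0\<close> is the left side of the claim because the transient at time 0 is
      \<open>mat 1 - exp_limit A\<close>.\<close>
    have "norm (h 0) \<le> M / a * norm U"
    proof (rule tendsto_lowerbound)
      have "((\<lambda>T. exp (- a * T)) \<longlongrightarrow> 0) at_top"
        using a by (intro filterlim_compose[OF exp_at_bot]
          filterlim_tendsto_neg_mult_at_bot[OF tendsto_const _ filterlim_ident]) simp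
      from tendsto_add[OF tendsto_const tendsto_mult_right_zero[OF this]]
      show "((\<lambda>T. M / a * norm U + M * norm X * exp (- a * T)) \<longlongrightarrow> M / a * norm U) at_top"
        by simp
      show "\<forall>\<^sub>F T in at_top. norm (h 0) \<le> M / a * norm U + M * norm X * exp (- a * T)"
        using eventually_gt_at_top[of 0] by eventually_elim (rule bound)
    qed simp
    then show ?thesis
      by (simp add: h_def D_def U_def cmat_diff cmat_mat)
  qed
  then show thesis using that by blast
qed

context
  fixes A :: "real ^ 'n ^ 'n" and J :: "complex ^ 'n ^ 'n"
  assumes semistable: "semistable A"
  defines "J \<equiv> cmat (exp_limit A)"
begin

lemma cmat_mult_exp_limit: "cmat A ** J = 0" "J ** cmat A = 0"
  unfolding J_def cmat_mult[symmetric]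
  by (simp_all add: mult_exp_limit[OF semistable] exp_limit_mult[OF semistable] cmat_eq_0_iff)

text \<open>A kernel vector is fixed by \<open>J\<close> according to
  \<open>resolvent_bound\<close>, hence is annihilated by \<open>A\<close> since
  \<open>A J = 0\<close>; then \<open>s\<close> times the vector vanishes as well.\<close>

lemma invertible_resolvent:
  assumes "Re s > 0"
  shows "invertible (mat s - cmat A)"
proof -
  have "v = 0" if v: "(mat s - cmat A) *v v = 0" for v
  proof -
    \<comment> \<open>The vector is turned into a one-column matrix, the shape that
      \<open>resolvent_bound\<close> expects.\<close>
    define X :: "complex ^ 1 ^ 'n" where "X = (\<chi> i j. v $ i)"
    have X: "(mat s - cmat A) ** X = 0"
      using v by (simp add: X_def vec_eq_iff matrix_matrix_mult_def matrix_vector_mult_def)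
    obtain K where "norm ((mat 1 - J) ** X) \<le> K * norm ((mat s - cmat A) ** X)"
      using resolvent_bound[OF semistable] assms unfolding J_def by (metis less_imp_le)
    then have "X = J ** X"
      using X by (simp add: matrix_mult_diff_distribs)
    then have "cmat A ** X = 0"
      by (metis cmat_mult_exp_limit(1) matrix_mul_assoc times0_left)
    then have "mat s ** X = 0"
      using X by (simp add: matrix_mult_diff_distribs)
    then have "X = 0"
      using assms by (auto simp: vec_eq_iff mat_mult_component)
    then show ?thesis
      by (simp add: X_def vec_eq_iff)
  qed
  then show ?thesis
    unfolding invertible_left_inverse matrix_left_invertible_ker by blast
qed

lemma resolvent_right_inverse:
  assumes "Re s > 0"
  shows "(mat s - cmat A) ** matrix_inv (mat s - cmat A) = mat 1"
  using someI_ex[OF invertible_resolvent[OF assms, unfolded invertible_def]]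
  unfolding matrix_inv_def by blast

lemma mat_mult_resolvent:
  assumes "Re s > 0"
  shows "mat s ** matrix_inv (mat s - cmat A) = mat 1 + cmat A ** matrix_inv (mat s - cmat A)"
  using resolvent_right_inverse[OF assms] by (simp add: matrix_mult_diff_distribs diff_eq_eq)

text \<open>Since \<open>J A = 0\<close>, multiplying \<open>s R = I + A R\<close> by
  \<open>J\<close> from the left leaves only \<open>J\<close>, where \<open>R\<close> is the
  resolvent. This isolates the simple pole at the origin.\<close>

lemma exp_limit_mult_resolvent:
  assumes "Re s > 0"
  shows "mat s ** (J ** matrix_inv (mat s - cmat A)) = J"
proof -
  have "mat s ** (J ** matrix_inv (mat s - cmat A)) = J ** (mat s ** matrix_inv (mat s - cmat A))"
    by (simp add: mult_mat_mult)
  also have "\<dots> = J"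
    unfolding mat_mult_resolvent[OF assms] matrix_add_ldistrib
    by (simp add: matrix_mul_assoc cmat_mult_exp_limit)
  finally show ?thesis .
qed

text \<open>Cramer's rule writes each entry as a quotient of determinants, which are polynomials in
  holomorphic entries, with a denominator free of zeros in the half plane.\<close>

lemma resolvent_holomorphic:
  "(\<lambda>s. matrix_inv (mat s - cmat A) $ i $ j) holomorphic_on {s. Re s > 0}"
proof -
  define M where "M s = (mat s - cmat A)" for s
  \<comment> \<open>Column \<open>i\<close> of \<open>M s\<close> is replaced by the unit vector of
    index \<open>j\<close>, in the form in which \<open>cramer\<close> states its numerator.\<close>
  define N where "N s = (\<chi> k l. if l = i then axis j 1 $ k else M s $ k $ l)" for s
  have nz: "det (M s) \<noteq> 0" if "Re s > 0" for s
    using invertible_resolvent[OF that] by (simp add: M_def invertible_det_nz)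
  have M_comp: "(\<lambda>s. M s $ k $ l) holomorphic_on {s. Re s > 0}" for k l
    by (cases "k = l") (auto simp: M_def mat_def intro!: holomorphic_intros)
  have "(\<lambda>s. N s $ k $ l) holomorphic_on {s. Re s > 0}" for k l
    using M_comp[of k l] by (cases "l = i") (auto simp: N_def)
  then have "(\<lambda>s. det (N s) / det (M s)) holomorphic_on {s. Re s > 0}"
    using nz M_comp unfolding det_def by (intro holomorphic_intros) auto
  moreover have "matrix_inv (mat s - cmat A) $ i $ j = det (N s) / det (M s)" if "Re s > 0" for s
  proof -
    have "M s *v (matrix_inv (M s) *v axis j 1) = axis j 1"
      using resolvent_right_inverse[OF that] by (simp add: M_def matrix_vector_mul_assoc)
    from this[unfolded cramer[OF nz[OF that]]]
    have "(matrix_inv (M s) *v axis j 1) $ i = det (N s) / det (M s)"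
      by (simp add: N_def)
    then show ?thesis
      by (simp add: M_def matrix_vector_mult_axis)
  qed
  ultimately show ?thesis
    by (subst holomorphic_cong[OF refl]) auto
qed

end

subsection \<open>Hardy space membership\<close>

lemma transfer_matrix_holomorphic:
  assumes "semistable A"
  shows "matrix_holomorphic_on (transfer_matrix A B C) {s. Re s > 0}"
  unfolding matrix_holomorphic_on_def transfer_matrix_def matrix_matrix_mult_def
  by (auto intro!: holomorphic_intros resolvent_holomorphic[OF assms])

lemma norm_entry_le_onorm: "norm (M $ i $ j) \<le> onorm ((*v) M)"
  for M :: "'a::real_normed_field ^ 'n ^ 'm"
proof -
  have "norm (M $ i $ j) \<le> norm (M *v axis j 1)"
    unfolding matrix_vector_mult_axis[symmetric] by (rule Finite_Cartesian_Product.norm_nth_le)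
  also have "\<dots> \<le> onorm ((*v) M) * norm (axis j 1 :: 'a ^ 'n)"
    by (rule onorm[OF bounded_bilinear.bounded_linear_right[OF bounded_bilinear_matrix_vector_mult]])
  also have "norm (axis j 1 :: 'a ^ 'n) = 1"
    by (simp add: norm_vec_def L2_set_def axis_def if_distrib[of norm] if_distrib[of "\<lambda>x. x\<^sup>2"]
      cong: if_cong)
  finally show ?thesis by simp
qed

lemma onorm_matrix_le_norm: "onorm ((*v) M) \<le> norm M"
  for M :: "'a::real_normed_field ^ 'n ^ 'm"
  by (rule onorm_le) (rule norm_matrix_vector_mult_le)

section \<open>Splitting the transfer matrix into a stable part and a pole at the origin\<close>

context
  fixes A :: "real ^ 'n ^ 'n" and B :: "real ^ 'p ^ 'n" and C :: "real ^ 'n ^ 'q"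
    and G :: "complex \<Rightarrow> complex ^ 'p ^ 'q"
  assumes semistable: "semistable A"
  defines "G \<equiv> \<lambda>s. cmat C ** ((mat 1 - cmat (exp_limit A)) ** matrix_inv (mat s - cmat A)) ** cmat B"
begin

text \<open>Splitting the identity as \<open>(I - J) + J\<close> in front of the resolvent separates
  \<open>G\<close> from the pole. The factor \<open>s\<close> on both sides keeps the identity free
  of division.\<close>

lemma transfer_matrix_decomposition:
  assumes "Re s > 0"
  shows "mat s ** transfer_matrix A B C s = mat s ** G s + cmat (C ** exp_limit A ** B)"
proof -
  define R where "R = matrix_inv (mat s - cmat A)"
  have "mat s ** transfer_matrix A B C s - mat s ** G s
      = mat s ** (cmat C ** (cmat (exp_limit A) ** R) ** cmat B)"
    by (simp add: transfer_matrix_def G_def R_def[symmetric] matrix_mult_diff_distribs)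
  also have "\<dots> = cmat C ** (mat s ** (cmat (exp_limit A) ** R)) ** cmat B"
    by (simp only: mult_mat_mult matrix_mul_assoc[symmetric])
  finally have "mat s ** transfer_matrix A B C s - mat s ** G s
      = cmat C ** (mat s ** (cmat (exp_limit A) ** R)) ** cmat B" .
  then show ?thesis
    unfolding R_def exp_limit_mult_resolvent[OF semistable assms]
    by (simp add: cmat_mult algebra_simps)
qed

text \<open>The first bound is \<open>resolvent_bound\<close> applied to the resolvent itself and
  serves both Hardy spaces; the second gives decay of order \<open>1 / norm s\<close>, which square
  integrability requires.\<close>

lemma transfer_stable_part_bound:
  obtains K where "\<And>s. Re s > 0 \<Longrightarrow> norm (G s) \<le> K" "\<And>s. Re s > 0 \<Longrightarrow> norm s * norm (G s) \<le> K"
proof -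
  let ?J = "cmat (exp_limit A)" and ?R = "\<lambda>s. matrix_inv (mat s - cmat A)"
  obtain L where L: "\<And>s (X :: complex ^ 'n ^ 'n). Re s \<ge> 0 \<Longrightarrow>
      norm ((mat 1 - ?J) ** X) \<le> L * norm ((mat s - cmat A) ** X)"
    using resolvent_bound[OF semistable, where 'm = 'n] by metis
  define K where "K = L * norm (mat 1 :: complex ^ 'n ^ 'n)"
  have K: "norm ((mat 1 - ?J) ** ?R s) \<le> K" if "Re s > 0" for s
    using L[of s "?R s"] that resolvent_right_inverse[OF semistable that] by (simp add: K_def)
  have sandwich: "norm (cmat C ** X ** cmat B) \<le> norm C * norm B * N" if "norm X \<le> N"
    for X :: "complex ^ 'n ^ 'n" and N
  proof -
    have "norm (cmat C ** X ** cmat B) \<le> norm C * norm X * norm B"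
      by (rule order_trans[OF norm_matrix_mult_le])
        (auto simp: norm_cmat intro!: mult_right_mono order_trans[OF norm_matrix_mult_le])
    also have "\<dots> \<le> norm C * N * norm B"
      using that by (intro mult_right_mono mult_left_mono) auto
    finally show ?thesis by (simp add: mult_ac)
  qed
  \<comment> \<open>From \<open>s R = I + A R\<close> together with \<open>J A = 0\<close> and
    \<open>A J = 0\<close>: the growing factor \<open>s\<close> is traded for the fixed matrix
    \<open>A\<close>.\<close>
  have s_resolvent: "mat s ** ((mat 1 - ?J) ** ?R s)
      = (mat 1 - ?J) + cmat A ** ((mat 1 - ?J) ** ?R s)" if "Re s > 0" for s
  proof -
    have "mat s ** ((mat 1 - ?J) ** ?R s) = (mat 1 - ?J) ** (mat 1 + cmat A ** ?R s)"
      unfolding mult_mat_mult[symmetric] mat_mult_resolvent[OF semistable that] ..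
    also have "\<dots> = (mat 1 - ?J) + cmat A ** ((mat 1 - ?J) ** ?R s)"
      by (simp add: matrix_add_ldistrib matrix_mult_diff_distribs matrix_mul_assoc
        cmat_mult_exp_limit[OF semistable])
    finally show ?thesis .
  qed
  define K' where "K' = norm (mat 1 - ?J) + norm A * K"
  have K': "norm (mat s ** ((mat 1 - ?J) ** ?R s)) \<le> K'" if "Re s > 0" for s
    unfolding s_resolvent[OF that] K'_def
    using norm_matrix_mult_le[of "cmat A" "(mat 1 - ?J) ** ?R s"] mult_left_mono[OF K[OF that], of "norm A"]
    by (intro order_trans[OF norm_triangle_ineq]) (simp add: norm_cmat)
  show thesis
  proof
    fix s assume s: "Re s > 0"
    show "norm (G s) \<le> max (norm C * norm B * K) (norm C * norm B * K')"
      unfolding G_def using sandwich[OF K[OF s]] by simp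
    have "mat s ** G s = cmat C ** (mat s ** ((mat 1 - ?J) ** ?R s)) ** cmat B"
      unfolding G_def by (simp add: mult_mat_mult) (simp add: matrix_mul_assoc)
    then show "norm s * norm (G s) \<le> max (norm C * norm B * K) (norm C * norm B * K')"
      using sandwich[OF K'[OF s]] by (simp flip: norm_mat_mult)
  qed
qed

lemma transfer_matrix_eq_stable_part:
  assumes "C ** exp_limit A ** B = 0" "Re s > 0"
  shows "transfer_matrix A B C s = G s"
proof -
  have "mat s ** transfer_matrix A B C s = mat s ** G s"
    using transfer_matrix_decomposition[OF assms(2)] assms(1) by (simp add: cmat_eq_0_iff)
  then show ?thesis
    using assms(2) by (auto simp: vec_eq_iff mat_mult_component)
qed

lemma transfer_matrix_in_Hinf:
  assumes "C ** exp_limit A ** B = 0"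
  shows "in_Hinf (transfer_matrix A B C)"
proof -
  obtain K where "\<And>s. Re s > 0 \<Longrightarrow> norm (G s) \<le> K"
    using transfer_stable_part_bound by metis
  then have "Hinf_norm (transfer_matrix A B C) \<le> ereal K"
    unfolding Hinf_norm_def using onorm_matrix_le_norm
    by (intro SUP_least) (auto simp: transfer_matrix_eq_stable_part[OF assms] intro: order_trans)
  then show ?thesis
    unfolding in_Hinf_def using transfer_matrix_holomorphic[OF semistable] by auto
qed

lemma transfer_matrix_in_H2:
  assumes "C ** exp_limit A ** B = 0"
  shows "in_H2 (transfer_matrix A B C)"
proof -
  obtain K where K: "\<And>s. Re s > 0 \<Longrightarrow> norm (G s) \<le> K"
      "\<And>s. Re s > 0 \<Longrightarrow> norm s * norm (G s) \<le> K"
    using transfer_stable_part_bound by metis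
  \<comment> \<open>The sum of the squares of the two bounds, using that the modulus of
    \<open>Complex \<sigma> \<omega>\<close> is at least that of \<open>\<omega>\<close>. The
    majorant does not depend on \<open>\<sigma>\<close>, so it controls the supremum as
    well.\<close>
  have "(norm (G (Complex \<sigma> \<omega>)))\<^sup>2 \<le> 2 * K\<^sup>2 * inverse (1 + \<omega>\<^sup>2)" if "\<sigma> > 0" for \<sigma> \<omega>
  proof -
    let ?N = "norm (G (Complex \<sigma> \<omega>))"
    have "\<bar>\<omega>\<bar> * ?N \<le> K"
      using K(2)[of "Complex \<sigma> \<omega>"] abs_Im_le_cmod[of "Complex \<sigma> \<omega>"] that
      by (auto intro: order_trans[OF mult_right_mono])
    from power_mono[OF this, of 2] power_mono[OF K(1)[of "Complex \<sigma> \<omega>"], of 2] that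
    have "(1 + \<omega>\<^sup>2) * ?N\<^sup>2 \<le> 2 * K\<^sup>2"
      by (simp add: power_mult_distrib algebra_simps)
    moreover have "1 + \<omega>\<^sup>2 > 0"
      by (simp add: add_pos_nonneg)
    ultimately show ?thesis
      by (simp add: field_simps)
  qed
  then have "(SUP \<sigma>\<in>{0<..}. \<integral>\<^sup>+ \<omega>. ennreal ((norm (transfer_matrix A B C (Complex \<sigma> \<omega>)))\<^sup>2) \<partial>lborel)
      \<le> (\<integral>\<^sup>+ \<omega>. ennreal (2 * K\<^sup>2 * inverse (1 + \<omega>\<^sup>2)) \<partial>lborel)"
    by (intro SUP_least nn_integral_mono) (auto simp: transfer_matrix_eq_stable_part[OF assms])
  also have "\<dots> < \<infinity>"
  proof -
    have "integrable lborel (\<lambda>\<omega>::real. 2 * K\<^sup>2 * inverse (1 + \<omega>\<^sup>2))"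
      using integrable_inverse_1_plus_square
      by (simp add: set_integrable_def einterval_eq_UNIV del: times_divide_eq_right)
    then show ?thesis
      by (subst nn_integral_eq_integral) auto
  qed
  finally show ?thesis
    unfolding in_H2_def using transfer_matrix_holomorphic[OF semistable] by auto
qed

text \<open>Approaching the pole along the positive reals: by the decomposition, each entry of
  \<open>C J B\<close> is \<open>\<epsilon>\<close> times a difference of bounded quantities, and
  \<open>\<epsilon>\<close> is arbitrarily small.\<close>

lemma transfer_matrix_in_HinfD:
  assumes "in_Hinf (transfer_matrix A B C)"
  shows "C ** exp_limit A ** B = 0"
proof -
  obtain M where "Hinf_norm (transfer_matrix A B C) \<le> ereal M"
    using assms unfolding in_Hinf_def
    by (cases "Hinf_norm (transfer_matrix A B C)") auto
  then have M: "onorm ((*v) (transfer_matrix A B C s)) \<le> M" if "Re s > 0" for s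
    using that unfolding Hinf_norm_def SUP_le_iff by auto
  obtain K where K: "\<And>s. Re s > 0 \<Longrightarrow> norm (G s) \<le> K"
    using transfer_stable_part_bound by metis
  have "(C ** exp_limit A ** B) $ i $ j = 0" for i j
  proof -
    define c where "c = \<bar>(C ** exp_limit A ** B) $ i $ j\<bar>"
    have bound: "c \<le> \<epsilon> * (M + K)" if "\<epsilon> > 0" for \<epsilon>
    proof -
      let ?s = "of_real \<epsilon> :: complex"
      have "cmat (C ** exp_limit A ** B) $ i $ j
          = ?s * (transfer_matrix A B C ?s $ i $ j - G ?s $ i $ j)"
        using arg_cong[OF transfer_matrix_decomposition[of ?s], of "\<lambda>M. M $ i $ j"] that
        by (simp add: mat_mult_component algebra_simps)
      moreover have "c = norm (cmat (C ** exp_limit A ** B) $ i $ j)"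
        by (simp add: c_def)
      ultimately have "c = \<epsilon> * norm (transfer_matrix A B C ?s $ i $ j - G ?s $ i $ j)"
        using that by (simp only: norm_mult norm_of_real abs_of_pos)
      also have "\<dots> \<le> \<epsilon> * (M + K)"
      proof (intro mult_left_mono order_trans[OF norm_triangle_ineq4] add_mono)
        show "norm (transfer_matrix A B C ?s $ i $ j) \<le> M"
          using order_trans[OF norm_entry_le_onorm M[of ?s]] that by simp
        show "norm (G ?s $ i $ j) \<le> K"
          using order_trans[OF Finite_Cartesian_Product.norm_nth_le order_trans[OF Finite_Cartesian_Product.norm_nth_le K[of ?s]]] that by simp
      qed (use that in auto)
      finally show ?thesis .
    qed
    have "c \<le> 0"
    proof (rule tendsto_lowerbound)
      show "((\<lambda>\<epsilon>. \<epsilon> * (M + K)) \<longlongrightarrow> 0) (at_right 0)"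
        by (auto intro!: tendsto_eq_intros)
      show "\<forall>\<^sub>F \<epsilon> in at_right 0. c \<le> \<epsilon> * (M + K)"
        using eventually_at_right_less by eventually_elim (rule bound)
    qed simp
    then show ?thesis by (simp add: c_def)
  qed
  then show ?thesis by (simp add: vec_eq_iff)
qed

end

subsection \<open>The linear matrix inequality\<close>

lemma sum_UNIV_Plus: "(\<Sum>x\<in>UNIV. f x) = (\<Sum>a\<in>UNIV. f (Inl a)) + (\<Sum>b\<in>UNIV. f (Inr b))"
  for f :: "'a::finite + 'b::finite \<Rightarrow> 'c::comm_monoid_add"
  by (simp add: UNIV_Plus_UNIV[symmetric] sum.Plus del: UNIV_Plus_UNIV)

lemma inner_matrix_vector_mult: "x \<bullet> (M *v y) = (\<Sum>i\<in>UNIV. \<Sum>j\<in>UNIV. x $ i * (M $ i $ j * y $ j))"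
  for M :: "real ^ 'n ^ 'm"
  by (simp add: inner_vec_def matrix_vector_mult_def sum_distrib_left)

lemma block3_quadratic_form:
  fixes v :: "real ^ 'n" and u :: "real ^ 'p" and w :: "real ^ 'q"
  defines "x \<equiv> (\<chi> i. case i of Inl a \<Rightarrow> v $ a | Inr (Inl b) \<Rightarrow> u $ b | Inr (Inr c) \<Rightarrow> w $ c)"
  shows "x \<bullet> (block3 M11 M12 M13 M21 M22 M23 M31 M32 M33 *v x)
    = v \<bullet> (M11 *v v) + v \<bullet> (M12 *v u) + v \<bullet> (M13 *v w)
    + u \<bullet> (M21 *v v) + u \<bullet> (M22 *v u) + u \<bullet> (M23 *v w)
    + w \<bullet> (M31 *v v) + w \<bullet> (M32 *v u) + w \<bullet> (M33 *v w)"
  by (simp add: inner_matrix_vector_mult sum_UNIV_Plus block3_def x_def sum.distrib)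

lemma inner_transpose_matrix_vector: "x \<bullet> (transpose M *v y) = (M *v x) \<bullet> y"
  for M :: "real ^ 'n ^ 'm"
  by (metis dot_lmul_matrix inner_commute transpose_matrix_vector)

text \<open>A Schur complement step: testing the block form with a suitable third component
  eliminates it. With \<open>v\<close> as state, the first term is the derivative of the storage
  function \<open>v \<bullet> (K *v v)\<close> along the system, and the rest compares output with
  input.\<close>

lemma lmi_dissipation:
  fixes K :: "real ^ 'n ^ 'n" and B :: "real ^ 'p ^ 'n" and N :: "real ^ 'n ^ 'q"
  assumes "\<gamma> > 0" and K: "transpose K = K"
    and lmi: "neg_semidef (block3
      (transpose A ** K + K ** A) (K ** B) (transpose N)
      (transpose B ** K) (- (\<gamma> *\<^sub>R mat 1)) 0
      N 0 (- (\<gamma> *\<^sub>R mat 1)))"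
  shows "2 * (v \<bullet> (K *v (A *v v + B *v u))) + (norm (N *v v))\<^sup>2 / \<gamma> \<le> \<gamma> * (norm u)\<^sup>2"
proof -
  \<comment> \<open>The maximiser of
    \<open>2 * (w \<bullet> (N *v v)) - \<gamma> * (w \<bullet> w)\<close>, with maximal value
    \<open>(norm (N *v v))\<^sup>2 / \<gamma>\<close>.\<close>
  define w where "w = (1 / \<gamma>) *\<^sub>R (N *v v)"
  have K_sym: "y \<bullet> (K *v z) = z \<bullet> (K *v y)" for y z
    using inner_transpose_matrix_vector[of y K z] K by (simp add: inner_commute)
  have scaled: "(- (\<gamma> *\<^sub>R mat 1)) *v y = - (\<gamma> *\<^sub>R y)" for y :: "real ^ 'm"
    by (simp add: bounded_bilinear.minus_left[OF bounded_bilinear_matrix_vector_mult]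
      bounded_bilinear.scaleR_left[OF bounded_bilinear_matrix_vector_mult])
  define x :: "real ^ ('n + 'p + 'q)"
    where "x = (\<chi> i. case i of Inl a \<Rightarrow> v $ a | Inr (Inl b) \<Rightarrow> u $ b | Inr (Inr c) \<Rightarrow> w $ c)"
  have "x \<bullet> (block3 (transpose A ** K + K ** A) (K ** B) (transpose N) (transpose B ** K)
      (- (\<gamma> *\<^sub>R mat 1)) 0 N 0 (- (\<gamma> *\<^sub>R mat 1)) *v x) \<le> 0"
    using lmi unfolding neg_semidef_def by blast
  then have "v \<bullet> ((transpose A ** K + K ** A) *v v) + v \<bullet> ((K ** B) *v u) + v \<bullet> (transpose N *v w)
      + u \<bullet> ((transpose B ** K) *v v) - \<gamma> * (u \<bullet> u) + w \<bullet> (N *v v) - \<gamma> * (w \<bullet> w) \<le> 0"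
    unfolding x_def block3_quadratic_form by (simp add: scaled)
  moreover have "v \<bullet> ((transpose A ** K + K ** A) *v v) = 2 * (v \<bullet> (K *v (A *v v)))"
    using K_sym[of v "A *v v"]
    by (simp add: matrix_vector_mult_add_rdistrib inner_add_right inner_transpose_matrix_vector
      flip: matrix_vector_mul_assoc del: transpose_matrix_vector)
  moreover have "u \<bullet> ((transpose B ** K) *v v) = v \<bullet> (K *v (B *v u))"
    using K_sym[of v "B *v u"]
    by (simp add: inner_transpose_matrix_vector
      flip: matrix_vector_mul_assoc del: transpose_matrix_vector)
  moreover have "v \<bullet> (transpose N *v w) + w \<bullet> (N *v v) - \<gamma> * (w \<bullet> w) = (norm (N *v v))\<^sup>2 / \<gamma>"
    using \<open>\<gamma> > 0\<close>
    by (simp add: inner_transpose_matrix_vector w_def power2_norm_eq_inner field_simps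
      del: transpose_matrix_vector)
  ultimately show ?thesis
    by (simp add: power2_norm_eq_inner matrix_vector_right_distrib inner_add_right
      flip: matrix_vector_mul_assoc)
qed

text \<open>The matrix inequality concerns real vectors only. Real matrices act separately on real
  and imaginary parts, so complex signals are treated by adding two real inequalities.\<close>

definition Re_vec :: "complex ^ 'n \<Rightarrow> real ^ 'n" where "Re_vec v = (\<chi> i. Re (v $ i))"
definition Im_vec :: "complex ^ 'n \<Rightarrow> real ^ 'n" where "Im_vec v = (\<chi> i. Im (v $ i))"

lemma Re_vec_cmat: "Re_vec (cmat M *v v) = M *v Re_vec v"
  by (simp add: Re_vec_def vec_eq_iff matrix_vector_mult_def)

lemma Im_vec_cmat: "Im_vec (cmat M *v v) = M *v Im_vec v"
  by (simp add: Im_vec_def vec_eq_iff matrix_vector_mult_def)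

lemma norm_Re_Im_vec: "(norm v)\<^sup>2 = (norm (Re_vec v))\<^sup>2 + (norm (Im_vec v))\<^sup>2"
  by (simp add: norm_vec_power2 Re_vec_def Im_vec_def cmod_power2 sum.distrib)

lemma transfer_matrix_Hinf_norm_le:
  fixes A :: "real ^ 'n ^ 'n" and B :: "real ^ 'p ^ 'n" and C :: "real ^ 'n ^ 'q"
  assumes semistable: "semistable A" and CJB: "C ** exp_limit A ** B = 0"
    and "\<gamma> > 0" and K: "pos_semidef K"
    and lmi: "neg_semidef (block3
      (transpose A ** K + K ** A) (K ** B) (transpose (mat 1 - exp_limit A) ** transpose C)
      (transpose B ** K) (- (\<gamma> *\<^sub>R mat 1)) 0
      (C ** (mat 1 - exp_limit A)) 0 (- (\<gamma> *\<^sub>R mat 1)))"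
  shows "Hinf_norm (transfer_matrix A B C) \<le> ereal \<gamma>"
proof -
  define N where "N = C ** (mat 1 - exp_limit A)"
  have "norm (transfer_matrix A B C s *v u) \<le> \<gamma> * norm u" if s: "Re s > 0" for s u
  proof -
    \<comment> \<open>The state amplitude belonging to the input \<open>u\<close> at frequency
      \<open>s\<close>; it satisfies \<open>s v = A v + B u\<close>.\<close>
    define v where "v = matrix_inv (mat s - cmat A) *v (cmat B *v u)"
    have "(mat s - cmat A) *v v = cmat B *v u"
      by (simp add: v_def matrix_vector_mul_assoc matrix_mul_assoc resolvent_right_inverse[OF semistable s])
    then have "cmat A *v v + cmat B *v u = mat s *v v"
      by (simp add: matrix_vector_mult_diff_rdistrib diff_eq_eq add.commute)
    moreover have "mat s *v v = s *s v"
      by (simp add: vec_eq_iff matrix_vector_mult_def mat_def if_distrib if_distribR cong: if_cong)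
    ultimately have state: "cmat A *v v + cmat B *v u = s *s v" by simp
    \<comment> \<open>\<open>CJB\<close> enters here: it allows the output to be read through
      \<open>N\<close>, the matrix occurring in the inequality, in place of
      \<open>C\<close>.\<close>
    have out: "transfer_matrix A B C s *v u = cmat N *v v"
      unfolding transfer_matrix_eq_stable_part[OF semistable CJB s] N_def v_def
      by (simp add: cmat_mult cmat_diff cmat_mat matrix_vector_mul_assoc matrix_mul_assoc)
    have "A *v Re_vec v + B *v Re_vec u = Re_vec (s *s v)"
      unfolding state[symmetric] Re_vec_cmat[symmetric] by (simp add: Re_vec_def vec_eq_iff)
    then have re: "A *v Re_vec v + B *v Re_vec u = Re s *\<^sub>R Re_vec v - Im s *\<^sub>R Im_vec v"
      by (simp add: Re_vec_def Im_vec_def vec_eq_iff)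
    have "A *v Im_vec v + B *v Im_vec u = Im_vec (s *s v)"
      unfolding state[symmetric] Im_vec_cmat[symmetric] by (simp add: Im_vec_def vec_eq_iff)
    then have im: "A *v Im_vec v + B *v Im_vec u = Re s *\<^sub>R Im_vec v + Im s *\<^sub>R Re_vec v"
      by (simp add: Re_vec_def Im_vec_def vec_eq_iff)
    have K_sym: "y \<bullet> (K *v z) = z \<bullet> (K *v y)" for y z
      using K inner_transpose_matrix_vector[of z K y] by (simp add: pos_semidef_def inner_commute)
    \<comment> \<open>The cross terms carrying \<open>Im s\<close> have opposite signs in the two
      parts and cancel by the symmetry of \<open>K\<close>; only the factor \<open>Re s\<close>
      survives, which is positive.\<close>
    have "Re_vec v \<bullet> (K *v (A *v Re_vec v + B *v Re_vec u))
        + Im_vec v \<bullet> (K *v (A *v Im_vec v + B *v Im_vec u))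
        = Re s * (Re_vec v \<bullet> (K *v Re_vec v) + Im_vec v \<bullet> (K *v Im_vec v))"
      unfolding re im using K_sym[of "Im_vec v" "Re_vec v"]
      by (simp add: matrix_vector_mult_diff_distrib matrix_vector_right_distrib
        matrix_vector_mult_scaleR inner_diff_right inner_add_right distrib_left)
    also have "\<dots> \<ge> 0"
      using K s unfolding pos_semidef_def by (intro mult_nonneg_nonneg add_nonneg_nonneg) auto
    finally have storage: "0 \<le> Re_vec v \<bullet> (K *v (A *v Re_vec v + B *v Re_vec u))
        + Im_vec v \<bullet> (K *v (A *v Im_vec v + B *v Im_vec u))" .
    have "transpose K = K" using K by (simp add: pos_semidef_def)
    note dissipation = lmi_dissipation[OF \<open>\<gamma> > 0\<close> this lmi[folded matrix_transpose_mul, folded N_def]]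
    have "(norm (cmat N *v v))\<^sup>2 / \<gamma> \<le> \<gamma> * (norm u)\<^sup>2"
      using dissipation[of "Re_vec v" "Re_vec u"] dissipation[of "Im_vec v" "Im_vec u"] storage
      unfolding norm_Re_Im_vec Re_vec_cmat Im_vec_cmat add_divide_distrib distrib_left by linarith
    then have "(norm (cmat N *v v))\<^sup>2 \<le> (\<gamma> * norm u)\<^sup>2"
      using \<open>\<gamma> > 0\<close> by (simp add: pos_divide_le_eq power_mult_distrib power2_eq_square mult_ac)
    then show ?thesis
      unfolding out by (rule power2_le_imp_le) (use \<open>\<gamma> > 0\<close> in simp)
  qed
  then have "onorm ((*v) (transfer_matrix A B C s)) \<le> \<gamma>" if "Re s > 0" for s
    using that by (intro onorm_le)
  then show ?thesis
    unfolding Hinf_norm_def by (intro SUP_least) simp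
qed

theorem theorem4:
  fixes A :: "real ^ 'n ^ 'n" and B :: "real ^ 'p ^ 'n" and C :: "real ^ 'n ^ 'q"
    and J :: "real ^ 'n ^ 'n" and \<eta> :: "complex \<Rightarrow> complex ^ 'p ^ 'q"
  assumes "semistable A"
  defines "J \<equiv> exp_limit A"
  defines "\<eta> \<equiv> transfer_matrix A B C"
  shows "(in_H2 \<eta> \<and> in_Hinf \<eta> \<longleftrightarrow> C ** J ** B = 0) \<and>
    (C ** J ** B = 0 \<longrightarrow>
      (H2_norm A B C)\<^sup>2 = trace (C ** ctrl_gramian A B ** transpose C) \<and>
      (H2_norm A B C)\<^sup>2 = trace (transpose B ** obs_gramian A C ** B) \<and>
      (\<forall>\<gamma>>0.
        (\<exists>K. pos_semidef K \<and>
          neg_semidef (block3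
            (transpose A ** K + K ** A) (K ** B)            (transpose (mat 1 - J) ** transpose C)
            (transpose B ** K)          (- (\<gamma> *\<^sub>R mat 1)) 0
            (C ** (mat 1 - J))          0                   (- (\<gamma> *\<^sub>R mat 1))) \<and>
          transpose J ** K ** J = 0)
        \<longrightarrow> Hinf_norm \<eta> \<le> ereal \<gamma>))"
proof (intro conjI impI allI)
  show "in_H2 \<eta> \<and> in_Hinf \<eta> \<longleftrightarrow> C ** J ** B = 0"
    unfolding J_def \<eta>_def
    using transfer_matrix_in_H2[OF assms(1)] transfer_matrix_in_Hinf[OF assms(1)]
      transfer_matrix_in_HinfD[OF assms(1)] by blast
next
  assume "C ** J ** B = 0"
  then show "(H2_norm A B C)\<^sup>2 = trace (C ** ctrl_gramian A B ** transpose C)"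
    "(H2_norm A B C)\<^sup>2 = trace (transpose B ** obs_gramian A C ** B)"
    unfolding J_def by (rule H2_norm_power2[OF assms(1)])+
next
  fix \<gamma> :: real
  assume CJB: "C ** J ** B = 0" and "\<gamma> > 0"
    and "\<exists>K. pos_semidef K \<and>
      neg_semidef (block3
        (transpose A ** K + K ** A) (K ** B)            (transpose (mat 1 - J) ** transpose C)
        (transpose B ** K)          (- (\<gamma> *\<^sub>R mat 1)) 0
        (C ** (mat 1 - J))          0                   (- (\<gamma> *\<^sub>R mat 1))) \<and>
      transpose J ** K ** J = 0"
  then obtain K where K: "pos_semidef K"
    and lmi: "neg_semidef (block3
        (transpose A ** K + K ** A) (K ** B)            (transpose (mat 1 - J) ** transpose C)
        (transpose B ** K)          (- (\<gamma> *\<^sub>R mat 1)) 0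
        (C ** (mat 1 - J))          0                   (- (\<gamma> *\<^sub>R mat 1)))"
    by blast
  show "Hinf_norm \<eta> \<le> ereal \<gamma>"
    unfolding \<eta>_def
    by (rule transfer_matrix_Hinf_norm_le[OF assms(1) CJB[unfolded J_def] \<open>\<gamma> > 0\<close> K
      lmi[unfolded J_def]])
qed

end
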